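(* Let $d$ be an integer with $d\ge 6$ and $d\equiv 2\pmod 4$, put $d'=\lfloor d/4\rfloor$, let $k$ be a rational and $\varepsilon$ a positive real such that $$2\le k<2+\frac{1}{2d'}\qquad\text{and}\qquad \varepsilon\sum_{j=0}^{d'-1}(k-1)^{2j+1}\ \ge\ \frac{1}{k+\varepsilon}.$$ If $G$ is a fractionally $k$-colorable graph and $W\subseteq V(G)$ is a set of vertices at pairwise distance at least $d$, then every fractional $(k+\varepsilon)$-precoloring of $W$ extends to a fractional $(k+\varepsilon)$-coloring of $G$.
   Context: A fractional $m$-coloring of a graph (real $m>0$) assigns to each vertex a measurable subset of $[0,m)$ of Lebesgue measure one so that adjacent vertices receive disjoint sets; a graph is fractionally $k$-colorable if it has a fractional $k$-coloring. A fractional $m$-precoloring of a vertex set $W$ assigns measurable subsets of $[0,m)$ of measure one to the vertices of $W$; it extends if some fractional $m$-coloring of the whole graph agrees with it on $W$. Graphs are finite. *)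

theory Defs
  imports "HOL-Analysis.Analysis"
begin

definition simple_graph :: "'a set \<Rightarrow> ('a \<Rightarrow> 'a \<Rightarrow> bool) \<Rightarrow> bool" where
  "simple_graph V E \<longleftrightarrow> finite V \<and> (\<forall>u v. E u v \<longrightarrow> u \<in> V \<and> v \<in> V)
     \<and> (\<forall>u v. E u v \<longrightarrow> E v u) \<and> (\<forall>u. \<not> E u u)"

definition walk_from_to :: "('a \<Rightarrow> 'a \<Rightarrow> bool) \<Rightarrow> 'a \<Rightarrow> 'a \<Rightarrow> 'a list \<Rightarrow> bool" where
  "walk_from_to E u v p \<longleftrightarrow> p \<noteq> [] \<and> hd p = u \<and> last p = v
     \<and> (\<forall>i. Suc i < length p \<longrightarrow> E (p ! i) (p ! Suc i))"

text \<open>Graph distance between u and v is at least d (infinite distance allowed).\<close>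
definition dist_ge :: "('a \<Rightarrow> 'a \<Rightarrow> bool) \<Rightarrow> 'a \<Rightarrow> 'a \<Rightarrow> nat \<Rightarrow> bool" where
  "dist_ge E u v d \<longleftrightarrow> (\<forall>p. walk_from_to E u v p \<longrightarrow> d \<le> length p - 1)"

definition unit_set :: "real \<Rightarrow> real set \<Rightarrow> bool" where
  "unit_set m S \<longleftrightarrow> S \<subseteq> {0..<m} \<and> S \<in> sets lebesgue \<and> emeasure lebesgue S = 1"

definition fractional_coloring :: "'a set \<Rightarrow> ('a \<Rightarrow> 'a \<Rightarrow> bool) \<Rightarrow> real \<Rightarrow> ('a \<Rightarrow> real set) \<Rightarrow> bool" where
  "fractional_coloring V E m f \<longleftrightarrow> (\<forall>v\<in>V. unit_set m (f v))
     \<and> (\<forall>u\<in>V. \<forall>v\<in>V. E u v \<longrightarrow> f u \<inter> f v = {})"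

definition fractionally_colorable :: "'a set \<Rightarrow> ('a \<Rightarrow> 'a \<Rightarrow> bool) \<Rightarrow> real \<Rightarrow> bool" where
  "fractionally_colorable V E k \<longleftrightarrow> (\<exists>f. fractional_coloring V E k f)"

definition fractional_precoloring :: "'a set \<Rightarrow> real \<Rightarrow> ('a \<Rightarrow> real set) \<Rightarrow> bool" where
  "fractional_precoloring W m \<phi> \<longleftrightarrow> (\<forall>v\<in>W. unit_set m (\<phi> v))"

definition precoloring_extends :: "'a set \<Rightarrow> ('a \<Rightarrow> 'a \<Rightarrow> bool) \<Rightarrow> 'a set \<Rightarrow> real \<Rightarrow> ('a \<Rightarrow> real set) \<Rightarrow> bool" where
  "precoloring_extends V E W m \<phi> \<longleftrightarrow>
     (\<exists>f. fractional_coloring V E m f \<and> (\<forall>v\<in>W. f v = \<phi> v))"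

end

theory Submission
  imports Defs
begin

text \<open>
  Put K = k + eps and D = d'. A walk of two steps changes a fractional k-coloring by at most k - 2
  in measure, so k < 2 + 1/(2D) excludes odd closed walks of length at most 4D + 1. Hence the balls
  of radius 2D around the vertices of W are layered by independent sets, and no edge joins two balls.

  First re-embed a k-coloring c into [0, K) so that each of its atoms meets every precolored set
  phi(w) in the proportion 1/K; let Y be the union of the atoms and X the rest, of measure eps.
  This coloring is kept outside the balls. Inside the ball of w take chains
  {} = Q_0 <= ... <= Q_D = Y Int phi(w) and R_1 <= ... <= R_D <= Y - phi(w), where Q_i and R_i have
  densities q_i and r_i in every atom. A vertex v at distance 2(D-i)+1 from w receives
  (c(v) - Q_i) Un R_i, which has measure 1 if q_i = (k-1) r_i; a vertex at distance 2(D-i) receives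
  a subset of (c(v) Un Q_i Un X) - R_{i+1}, which is large enough if
  r_{i+1} <= (k-1) q_i + eps. Solving this recursion gives
  q_i = min (1/K) (eps * sum_{j<i} (k-1)^{2j+1}), and the hypothesis on eps says q_D = 1/K, so that
  the vertex w itself can be given phi(w).
\<close>

section \<open>Cutting sets of prescribed measure out of bounded measurable sets\<close>

lemma lmeasurable_of_subset_interval:
  fixes S :: "real set"
  assumes "S \<in> sets lebesgue" "S \<subseteq> {0..<m}"
  shows "S \<in> lmeasurable"
  using assms bounded_subset[of "{0..<m}" S] by (intro bounded_set_imp_lmeasurable) auto

text \<open>Cut \<open>S\<close> by a moving left half-line: the measure of the part below
  \<open>x\<close> is a continuous function of \<open>x\<close>, so the intermediate value theorem
  finds a cut point for each value. Keeping one nested family, rather than one subset per value, is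
  what later yields the chains used at successive levels.\<close>

lemma exists_increasing_subsets:
  fixes S :: "real set"
  assumes S: "S \<in> sets lebesgue" "S \<subseteq> {0..<m}"
  shows "\<exists>B. (\<forall>s t. 0 \<le> s \<longrightarrow> s \<le> t \<longrightarrow> t \<le> measure lebesgue S \<longrightarrow> B s \<subseteq> B t)
    \<and> (\<forall>s. B s \<subseteq> S \<and> B s \<in> sets lebesgue)
    \<and> (\<forall>s. 0 \<le> s \<longrightarrow> s \<le> measure lebesgue S \<longrightarrow> measure lebesgue (B s) = s)"
proof -
  define F where "F x = measure lebesgue (S \<inter> {..<x})" for x
  have meas: "S \<inter> {..<x} \<in> lmeasurable" for x
    using S by (intro lmeasurable_of_subset_interval[of _ m] sets.Int) auto
  have mono: "F x \<le> F y" if "x \<le> y" for x y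
    unfolding F_def using that by (intro measure_mono_fmeasurable) (auto simp: meas fmeasurableD)
  have lip: "F y \<le> F x + (y - x)" if "x \<le> y" for x y
  proof -
    have "F y \<le> measure lebesgue ((S \<inter> {..<x}) \<union> {x..y})"
      unfolding F_def by (intro measure_mono_fmeasurable) (auto simp: meas fmeasurableD intro!: fmeasurable.Un)
    also have "\<dots> \<le> F x + measure lebesgue {x..y}"
      unfolding F_def by (intro measure_Un_le) (auto simp: meas fmeasurableD)
    finally show ?thesis using that by simp
  qed
  \<comment> \<open>The absolute value keeps the interval nonempty when \<open>m\<close> is
    negative; in that case \<open>S\<close> is empty.\<close>
  have cont: "continuous_on {0..\<bar>m\<bar>} F"
  proof (rule continuous_on_subset[OF lipschitz_on_continuous_on])
    show "1-lipschitz_on UNIV F"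
    proof (rule lipschitz_onI)
      fix x y :: real
      show "dist (F x) (F y) \<le> 1 * dist x y"
        using mono[of x y] mono[of y x] lip[of x y] lip[of y x]
        by (cases "x \<le> y") (auto simp: dist_real_def)
    qed simp
  qed simp
  have F0: "F 0 = 0"
  proof -
    have "S \<inter> {..<0} = {}" using S by auto
    then show ?thesis by (simp add: F_def)
  qed
  have Fm: "F \<bar>m\<bar> = measure lebesgue S"
  proof -
    have "S \<inter> {..<\<bar>m\<bar>} = S" using S by auto
    then show ?thesis by (simp add: F_def)
  qed
  have "\<exists>x. F x = s" if "0 \<le> s" "s \<le> measure lebesgue S" for s
    using IVT'[of F 0 s "\<bar>m\<bar>"] cont F0 Fm that by auto
  then obtain \<tau> where \<tau>: "\<And>s. 0 \<le> s \<Longrightarrow> s \<le> measure lebesgue S \<Longrightarrow> F (\<tau> s) = s"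
    by metis
  have \<tau>_mono: "S \<inter> {..<\<tau> s} \<subseteq> S \<inter> {..<\<tau> t}"
    if st: "0 \<le> s" "s \<le> t" "t \<le> measure lebesgue S" for s t
  proof -
    \<comment> \<open>Cut points are chosen arbitrarily where \<open>F\<close> is flat. An inversion
      would still force \<open>t\<close> \<le> \<open>s\<close>, hence \<open>s = t\<close> and the
      same cut point.\<close>
    have "\<tau> s \<le> \<tau> t"
    proof (rule ccontr)
      assume "\<not> \<tau> s \<le> \<tau> t"
      then have "t \<le> s" using mono[of "\<tau> t" "\<tau> s"] \<tau>[of s] \<tau>[of t] st by auto
      then show False using st \<open>\<not> \<tau> s \<le> \<tau> t\<close> by auto
    qed
    then show ?thesis by auto
  qed
  have \<tau>_meas: "S \<inter> {..<\<tau> s} \<in> sets lebesgue" for s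
    using meas by (rule fmeasurableD)
  show ?thesis
    using \<tau>_mono \<tau>_meas \<tau>[unfolded F_def]
    by (intro exI[of _ "\<lambda>s. S \<inter> {..<\<tau> s}"] conjI allI impI) blast+
qed

text \<open>Greedy choice: cut off a piece for one index and continue in the rest of
  \<open>S\<close>, whose measure still covers the remaining demands.\<close>

lemma exists_disjoint_subsets:
  fixes a :: "'t \<Rightarrow> real" and S :: "real set"
  assumes "finite T" "\<And>t. t \<in> T \<Longrightarrow> 0 \<le> a t"
    and "S \<in> sets lebesgue" "S \<subseteq> {0..<m}" "sum a T \<le> measure lebesgue S"
  shows "\<exists>A. disjoint_family_on A T \<and>
    (\<forall>t\<in>T. A t \<subseteq> S \<and> A t \<in> sets lebesgue \<and> measure lebesgue (A t) = a t)"
  using assms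
proof (induction T arbitrary: S rule: finite_induct)
  case empty
  then show ?case by (auto simp: disjoint_family_on_def)
next
  case (insert t T)
  obtain B where B: "B \<subseteq> S" "B \<in> sets lebesgue" "measure lebesgue B = a t"
  proof -
    have "sum a T \<ge> 0" using insert.prems by (intro sum_nonneg) auto
    then have "0 \<le> a t" "a t \<le> measure lebesgue S" using insert by auto
    then show thesis
      using exists_increasing_subsets[OF insert.prems(2,3)] that by metis
  qed
  have "S \<in> lmeasurable"
    using insert.prems lmeasurable_of_subset_interval by blast
  then have "measure lebesgue (S - B) = measure lebesgue S - measure lebesgue B"
    using B by (intro measurable_measure_Diff) auto
  then have "\<exists>A. disjoint_family_on A T \<and>
    (\<forall>t\<in>T. A t \<subseteq> S - B \<and> A t \<in> sets lebesgue \<and> measure lebesgue (A t) = a t)"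
    using insert.prems insert.hyps B by (intro insert.IH) auto
  then obtain A where A: "disjoint_family_on A T"
    "\<And>t. t \<in> T \<Longrightarrow> A t \<subseteq> S - B \<and> A t \<in> sets lebesgue \<and> measure lebesgue (A t) = a t"
    by blast
  have "disjoint_family_on (A(t := B)) (insert t T)"
    using A insert.hyps by (fastforce simp: disjoint_family_on_def)
  moreover have "\<forall>s\<in>insert t T. (A(t := B)) s \<subseteq> S \<and> (A(t := B)) s \<in> sets lebesgue
      \<and> measure lebesgue ((A(t := B)) s) = a s"
    using A B insert.hyps by auto
  ultimately show ?case by blast
qed

lemma measure_UNION_disjoint:
  assumes "finite I" "disjoint_family_on A I"
    and "\<And>i. i \<in> I \<Longrightarrow> A i \<in> sets lebesgue" "\<And>i. i \<in> I \<Longrightarrow> A i \<subseteq> {0..<m::real}"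
  shows "measure lebesgue (\<Union>i\<in>I. A i) = (\<Sum>i\<in>I. measure lebesgue (A i))"
proof (rule measure_finite_Union)
  fix i assume "i \<in> I"
  then have "A i \<in> lmeasurable"
    using assms lmeasurable_of_subset_interval by blast
  then show "emeasure lebesgue (A i) \<noteq> \<infinity>"
    using fmeasurableD2 by (metis infinity_ennreal_def)
qed (use assms in auto)

section \<open>Embedding a color distribution independently of the precoloring\<close>

lemma atom_measurable:
  assumes "finite I" "\<And>i. i \<in> I \<Longrightarrow> f i \<in> sets M" "S \<in> sets M"
  shows "{x\<in>S. {i\<in>I. x \<in> f i} = J} \<in> sets M"
proof (cases "J \<subseteq> I")
  case True
  have "{x\<in>S. {i\<in>I. x \<in> f i} = J} = S - (\<Union>i\<in>J. S - f i) - (\<Union>i\<in>I - J. f i)"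
    using True by blast
  moreover have "finite J" using True assms(1) finite_subset by blast
  then have "(\<Union>i\<in>J. S - f i) \<in> sets M"
    using assms True by (intro sets.finite_UN sets.Diff) blast+
  moreover have "(\<Union>i\<in>I - J. f i) \<in> sets M"
    using assms by (intro sets.finite_UN) blast+
  ultimately show ?thesis
    using assms(3) by (simp only: sets.Diff)
next
  case False
  then have "{x\<in>S. {i\<in>I. x \<in> f i} = J} = {}" by auto
  then show ?thesis by (simp only: sets.empty_sets)
qed

text \<open>The sets \<phi> w split [0, K) into finitely many atoms \<open>P J\<close>, where
  \<open>J\<close> lists the \<open>w\<close> whose set contains the point. Each index
  \<open>t\<close> receives the share \<open>a t / K\<close> of every atom. Adding over all atoms
  gives \<open>a t\<close>, and adding over the atoms with \<open>w\<close> in \<open>J\<close>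
  gives the same share of \<phi> w.\<close>

lemma exists_equidistributed_family:
  fixes a :: "'t \<Rightarrow> real" and \<phi> :: "'a \<Rightarrow> real set"
  assumes "finite W" "0 < K" "\<And>w. w \<in> W \<Longrightarrow> \<phi> w \<in> sets lebesgue"
    "\<And>w. w \<in> W \<Longrightarrow> \<phi> w \<subseteq> {0..<K}"
    "finite T" "\<And>t. t \<in> T \<Longrightarrow> 0 \<le> a t" "sum a T \<le> K"
  obtains A where "disjoint_family_on A T" "\<And>t. t \<in> T \<Longrightarrow> A t \<subseteq> {0..<K}"
    "\<And>t. t \<in> T \<Longrightarrow> A t \<in> sets lebesgue"
    "\<And>t. t \<in> T \<Longrightarrow> measure lebesgue (A t) = a t"
    "\<And>t w. t \<in> T \<Longrightarrow> w \<in> W \<Longrightarrow> measure lebesgue (A t \<inter> \<phi> w) = a t * measure lebesgue (\<phi> w) / K"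
proof -
  define P where "P J = {x\<in>{0..<K}. {w\<in>W. x \<in> \<phi> w} = J}" for J
  have Pm: "P J \<in> sets lebesgue" for J
    unfolding P_def using assms by (intro atom_measurable) auto
  have PK: "P J \<subseteq> {0..<K}" for J by (auto simp: P_def)
  have Pdis: "disjoint_family_on P \<J>" for \<J> by (auto simp: disjoint_family_on_def P_def)
  have "\<exists>A. disjoint_family_on A T \<and> (\<forall>t\<in>T. A t \<subseteq> P J \<and> A t \<in> sets lebesgue
      \<and> measure lebesgue (A t) = a t * (measure lebesgue (P J) / K))" for J
  proof (rule exists_disjoint_subsets[OF assms(5) _ Pm PK])
    \<comment> \<open>The shares fit into \<open>P J\<close> because the total of \<open>a\<close>
      is at most \<open>K\<close>.\<close>
    have "(\<Sum>t\<in>T. a t * (measure lebesgue (P J) / K)) = sum a T / K * measure lebesgue (P J)"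
      by (simp add: sum_distrib_right sum_divide_distrib)
    also have "\<dots> \<le> 1 * measure lebesgue (P J)"
      using assms by (intro mult_right_mono) auto
    finally show "(\<Sum>t\<in>T. a t * (measure lebesgue (P J) / K)) \<le> measure lebesgue (P J)" by simp
  qed (use assms in auto)
  then obtain C where C: "\<And>J. disjoint_family_on (C J) T"
    "\<And>J t. t \<in> T \<Longrightarrow> C J t \<subseteq> P J" "\<And>J t. t \<in> T \<Longrightarrow> C J t \<in> sets lebesgue"
    "\<And>J t. t \<in> T \<Longrightarrow> measure lebesgue (C J t) = a t * (measure lebesgue (P J) / K)"
    by metis
  define A where "A t = (\<Union>J\<in>Pow W. C J t)" for t
  have CP: "x \<in> P J" if "x \<in> C J t" "t \<in> T" for x J t using C(2) that by blast
  have CJ: "{w\<in>W. x \<in> \<phi> w} = J" if "x \<in> C J t" "t \<in> T" for x J t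
    using CP[OF that] by (simp add: P_def)
  have fin: "finite (Pow W)" using assms by simp
  have measU: "measure lebesgue (\<Union>J\<in>\<J>. C J t)
      = a t * measure lebesgue (\<Union>J\<in>\<J>. P J) / K" if t: "t \<in> T" and "\<J> \<subseteq> Pow W" for t \<J>
  proof -
    have fJ: "finite \<J>" using that fin finite_subset by blast
    have "measure lebesgue (\<Union>J\<in>\<J>. C J t) = (\<Sum>J\<in>\<J>. measure lebesgue (C J t))"
    proof (rule measure_UNION_disjoint[OF fJ])
      show "disjoint_family_on (\<lambda>J. C J t) \<J>"
        using CJ[OF _ t] unfolding disjoint_family_on_def by blast
      show "C J t \<in> sets lebesgue" for J by (rule C(3)[OF t])
      show "C J t \<subseteq> {0..<K}" for J using C(2)[OF t] PK by (rule order_trans)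
    qed
    also have "\<dots> = a t * (\<Sum>J\<in>\<J>. measure lebesgue (P J)) / K"
      using C(4) t by (simp add: sum_distrib_left sum_divide_distrib)
    also have "(\<Sum>J\<in>\<J>. measure lebesgue (P J)) = measure lebesgue (\<Union>J\<in>\<J>. P J)"
      by (rule measure_UNION_disjoint[OF fJ Pdis Pm PK, symmetric])
    finally show ?thesis .
  qed
  show thesis
  proof (rule that[of A])
    show "disjoint_family_on A T"
      unfolding disjoint_family_on_def
    proof (intro ballI impI)
      fix s t assume st: "s \<in> T" "t \<in> T" "s \<noteq> t"
      show "A s \<inter> A t = {}"
      proof (rule equals0I)
        fix x assume "x \<in> A s \<inter> A t"
        then obtain I J where x: "x \<in> C I s" "x \<in> C J t" by (auto simp: A_def)
        then have "x \<in> P I" "x \<in> P J" using CP st by blast+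
        then have "I = J" by (auto simp: P_def)
        then show False using x disjoint_family_onD[OF C(1)[of I] st] by blast
      qed
    qed
    fix t assume t: "t \<in> T"
    show "A t \<subseteq> {0..<K}" proof
      fix x assume "x \<in> A t"
      then obtain J where "x \<in> C J t" by (auto simp: A_def)
      from CP[OF this t] show "x \<in> {0..<K}" by (simp add: P_def)
    qed
    show "A t \<in> sets lebesgue" unfolding A_def using C(3)[OF t] by (intro sets.finite_UN fin)
    have "(\<Union>J\<in>Pow W. P J) = {0..<K}"
    proof (intro equalityI UN_least PK subsetI)
      fix x assume "x \<in> {0..<K}"
      then have "x \<in> P {w\<in>W. x \<in> \<phi> w}" by (simp add: P_def)
      then show "x \<in> (\<Union>J\<in>Pow W. P J)" by (rule UN_I[rotated]) simp
    qed
    then have "measure lebesgue (\<Union>J\<in>Pow W. P J) = K" using assms(2) by simp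
    then show "measure lebesgue (A t) = a t"
      unfolding A_def measU[OF t order_refl] using assms(2) by simp
    fix w assume w: "w \<in> W"
    have sub: "{J\<in>Pow W. w \<in> J} \<subseteq> Pow W" by blast
    have "x \<in> A t \<inter> \<phi> w \<longleftrightarrow> x \<in> (\<Union>J\<in>{J\<in>Pow W. w \<in> J}. C J t)" for x
      using CJ[OF _ t, of x] w by (auto simp: A_def)
    then have 1: "A t \<inter> \<phi> w = (\<Union>J\<in>{J\<in>Pow W. w \<in> J}. C J t)" by (rule set_eqI)
    have "x \<in> (\<Union>J\<in>{J\<in>Pow W. w \<in> J}. P J) \<longleftrightarrow> x \<in> \<phi> w" for x
      using w assms(4)[OF w] by (auto simp: P_def)
    then have 2: "(\<Union>J\<in>{J\<in>Pow W. w \<in> J}. P J) = \<phi> w" by (rule set_eqI)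
    show "measure lebesgue (A t \<inter> \<phi> w) = a t * measure lebesgue (\<phi> w) / K"
      unfolding 1 measU[OF t sub] 2 ..
  qed
qed

section \<open>Additivity of measure and unit sets\<close>

lemma measure_Un_disjoint_interval:
  fixes A B :: "real set"
  assumes "A \<in> sets lebesgue" "A \<subseteq> {0..<m}" "B \<in> sets lebesgue" "B \<subseteq> {0..<m}" "A \<inter> B = {}"
  shows "measure lebesgue (A \<union> B) = measure lebesgue A + measure lebesgue B"
proof (rule measure_Union)
  have "A \<in> lmeasurable" "B \<in> lmeasurable"
    using assms lmeasurable_of_subset_interval by blast+
  then show "emeasure lebesgue A \<noteq> \<infinity>" "emeasure lebesgue B \<noteq> \<infinity>"
    using fmeasurableD2 by (metis infinity_ennreal_def)+
qed (use assms in simp_all)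

lemma unit_set_iff_measure:
  "unit_set m S \<longleftrightarrow> S \<subseteq> {0..<m} \<and> S \<in> sets lebesgue \<and> measure lebesgue S = 1"
proof -
  have "emeasure lebesgue S = 1 \<longleftrightarrow> measure lebesgue S = 1" if "S \<subseteq> {0..<m}" "S \<in> sets lebesgue"
  proof -
    have "emeasure lebesgue S = ennreal (measure lebesgue S)"
      using lmeasurable_of_subset_interval[OF that(2,1)] by (rule emeasure_eq_measure2)
    then show ?thesis by (simp only: ennreal_eq_1)
  qed
  then show ?thesis unfolding unit_set_def by blast
qed

lemma unit_subset_exists:
  assumes "S \<in> sets lebesgue" "S \<subseteq> {0..<m}" "1 \<le> measure lebesgue S"
  shows "\<exists>B. unit_set m B \<and> B \<subseteq> S"
proof -
  obtain B where B: "\<And>s. B s \<subseteq> S" "\<And>s. B s \<in> sets lebesgue"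
    "\<And>s. 0 \<le> s \<Longrightarrow> s \<le> measure lebesgue S \<Longrightarrow> measure lebesgue (B s) = s"
    using exists_increasing_subsets[OF assms(1,2)] by blast
  have "unit_set m (B 1)"
    unfolding unit_set_iff_measure using B(1,2)[of 1] B(3)[of 1] assms by simp
  then show ?thesis using B(1) by blast
qed

section \<open>Unions of color cells, sets of uniform density, and colorings of a ball by
  levels\<close>

locale color_cells =
  fixes T :: "'t set" and A :: "'t \<Rightarrow> real set" and K :: real
  assumes finite_T: "finite T"
    and disj: "disjoint_family_on A T"
    and cell_sub: "t \<in> T \<Longrightarrow> A t \<subseteq> {0..<K}"
    and cell_meas: "t \<in> T \<Longrightarrow> A t \<in> sets lebesgue"
begin

text \<open>Colors are handled through their index sets, so that disjointness of colors becomes a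
  combinatorial condition on subsets of \<open>T\<close>.\<close>

definition palette :: "'t set \<Rightarrow> real set" where
  "palette I = (\<Union>t\<in>I. A t)"

text \<open>Uniformity over the cells makes the measure that \<open>Z\<close> removes from a palette
  depend only on the measure of the palette. One set \<open>Z\<close> can therefore serve all
  vertices of a level at once.\<close>

definition has_density :: "real set \<Rightarrow> real \<Rightarrow> bool" where
  "has_density Z z \<longleftrightarrow> Z \<in> sets lebesgue \<and> Z \<subseteq> palette T
    \<and> (\<forall>t\<in>T. measure lebesgue (A t \<inter> Z) = z * measure lebesgue (A t))"

lemma palette_sub: "I \<subseteq> T \<Longrightarrow> palette I \<subseteq> {0..<K}"
  unfolding palette_def using cell_sub by blast

lemma palette_mono: "I \<subseteq> J \<Longrightarrow> palette I \<subseteq> palette J"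
  by (auto simp: palette_def)

lemma palette_meas: "I \<subseteq> T \<Longrightarrow> palette I \<in> sets lebesgue"
  unfolding palette_def using finite_subset[OF _ finite_T] cell_meas
  by (intro sets.finite_UN) blast+

lemma palette_disjoint:
  assumes "I \<subseteq> T" "J \<subseteq> T" "I \<inter> J = {}"
  shows "palette I \<inter> palette J = {}"
proof (rule equals0I)
  fix x assume "x \<in> palette I \<inter> palette J"
  then obtain s t where "s \<in> I" "t \<in> J" "x \<in> A s" "x \<in> A t" by (auto simp: palette_def)
  then show False using disjoint_family_onD[OF disj, of s t] assms by blast
qed

lemma measure_palette:
  assumes "I \<subseteq> T"
  shows "measure lebesgue (palette I) = (\<Sum>t\<in>I. measure lebesgue (A t))"
  unfolding palette_def
proof (rule measure_UNION_disjoint[of _ _ K])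
  show "finite I" using assms finite_T finite_subset by blast
  show "disjoint_family_on A I" using assms disj disjoint_family_on_mono by blast
  show "A t \<in> sets lebesgue" "A t \<subseteq> {0..<K}" if "t \<in> I" for t
    using that assms cell_sub cell_meas by blast+
qed

lemma has_density_sub: "has_density Z z \<Longrightarrow> Z \<subseteq> {0..<K}"
  using palette_sub[of T] by (auto simp: has_density_def)

lemma has_density_Int:
  assumes "has_density Z z" "I \<subseteq> T"
  shows "measure lebesgue (palette I \<inter> Z) = z * measure lebesgue (palette I)"
proof -
  have "palette I \<inter> Z = (\<Union>t\<in>I. A t \<inter> Z)" by (auto simp: palette_def)
  also have "measure lebesgue \<dots> = (\<Sum>t\<in>I. measure lebesgue (A t \<inter> Z))"
  proof (rule measure_UNION_disjoint[of _ _ K])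
    show "finite I" using assms finite_T finite_subset by blast
    show "disjoint_family_on (\<lambda>t. A t \<inter> Z) I"
      using disj assms(2) unfolding disjoint_family_on_def by blast
    fix t assume "t \<in> I"
    then have "t \<in> T" using assms by blast
    then show "A t \<inter> Z \<in> sets lebesgue" "A t \<inter> Z \<subseteq> {0..<K}"
      using cell_meas[of t] cell_sub[of t] assms(1) by (auto simp: has_density_def)
  qed
  also have "\<dots> = z * measure lebesgue (palette I)"
    unfolding measure_palette[OF assms(2)] sum_distrib_left
    using assms by (intro sum.cong) (auto simp: has_density_def)
  finally show ?thesis .
qed

lemma measure_has_density:
  assumes "has_density Z z"
  shows "measure lebesgue Z = z * measure lebesgue (palette T)"
proof -
  have "palette T \<inter> Z = Z" using assms by (auto simp: has_density_def)
  then show ?thesis using has_density_Int[OF assms order_refl] by simp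
qed

lemma measure_palette_Diff:
  assumes "has_density Z z" "I \<subseteq> T"
  shows "measure lebesgue (palette I - Z) = (1 - z) * measure lebesgue (palette I)"
proof -
  have Z: "Z \<in> sets lebesgue" using assms by (simp add: has_density_def)
  have "measure lebesgue ((palette I - Z) \<union> (palette I \<inter> Z))
      = measure lebesgue (palette I - Z) + measure lebesgue (palette I \<inter> Z)"
    using palette_meas[OF assms(2)] palette_sub[OF assms(2)] Z
    by (intro measure_Un_disjoint_interval[of _ K]) auto
  moreover have "(palette I - Z) \<union> (palette I \<inter> Z) = palette I" by blast
  ultimately show ?thesis using has_density_Int[OF assms] by (simp add: algebra_simps)
qed

lemma has_density_Un:
  assumes "has_density Z z" "has_density Y y" "Z \<inter> Y = {}"
  shows "has_density (Z \<union> Y) (z + y)"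
  unfolding has_density_def
proof (intro conjI ballI)
  fix t assume t: "t \<in> T"
  have "A t \<inter> (Z \<union> Y) = (A t \<inter> Z) \<union> (A t \<inter> Y)" by blast
  also have "measure lebesgue \<dots> = measure lebesgue (A t \<inter> Z) + measure lebesgue (A t \<inter> Y)"
    using cell_meas[OF t] cell_sub[OF t] assms
    by (intro measure_Un_disjoint_interval[of _ K]) (auto simp: has_density_def)
  finally show "measure lebesgue (A t \<inter> (Z \<union> Y)) = (z + y) * measure lebesgue (A t)"
    using assms t by (simp add: has_density_def algebra_simps)
qed (use assms in \<open>auto simp: has_density_def\<close>)

text \<open>Run the increasing family of each cell at a speed proportional to the measure of that
  cell, and take the union over the cells at equal density.\<close>

lemma exists_density_chain:
  assumes "S \<in> sets lebesgue"
    and "\<And>t. t \<in> T \<Longrightarrow> measure lebesgue (A t \<inter> S) = \<delta> * measure lebesgue (A t)"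
  obtains Z where "\<And>z. 0 \<le> z \<Longrightarrow> z \<le> \<delta> \<Longrightarrow> has_density (Z z) z"
    "\<And>z. Z z \<subseteq> palette T \<inter> S" "\<And>y z. 0 \<le> y \<Longrightarrow> y \<le> z \<Longrightarrow> z \<le> \<delta> \<Longrightarrow> Z y \<subseteq> Z z"
proof -
  define P where "P t B \<longleftrightarrow>
      (\<forall>s u. 0 \<le> s \<longrightarrow> s \<le> u \<longrightarrow> u \<le> \<delta> * measure lebesgue (A t) \<longrightarrow> B s \<subseteq> B u)
    \<and> (\<forall>s::real. B s \<subseteq> A t \<inter> S \<and> B s \<in> sets lebesgue)
    \<and> (\<forall>s. 0 \<le> s \<longrightarrow> s \<le> \<delta> * measure lebesgue (A t) \<longrightarrow> measure lebesgue (B s) = s)" for t B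
  have "\<forall>t\<in>T. \<exists>B. P t B"
  proof
    fix t assume t: "t \<in> T"
    have f: "A t \<inter> S \<in> sets lebesgue" "A t \<inter> S \<subseteq> {0..<K}"
      using cell_meas[OF t] cell_sub[OF t] assms by auto
    show "\<exists>B. P t B"
      using exists_increasing_subsets[OF f] unfolding assms(2)[OF t] P_def .
  qed
  from bchoice[OF this] obtain B where B': "\<And>t. t \<in> T \<Longrightarrow> P t (B t)" by blast
  have Bmono: "B t s \<subseteq> B t u"
    if "t \<in> T" "0 \<le> s" "s \<le> u" "u \<le> \<delta> * measure lebesgue (A t)" for t s u
    using B'[OF that(1)] that unfolding P_def by blast
  have Bsub: "B t s \<subseteq> A t \<inter> S" and Bmeas: "B t s \<in> sets lebesgue" if "t \<in> T" for t s
    using B'[OF that] unfolding P_def by blast+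
  have B: "measure lebesgue (B t s) = s"
    if "t \<in> T" "0 \<le> s" "s \<le> \<delta> * measure lebesgue (A t)" for t s
    using B'[OF that(1)] that unfolding P_def by blast
  define Z where "Z z = (\<Union>t\<in>T. B t (z * measure lebesgue (A t)))" for z
  show thesis
  proof (rule that[of Z])
    fix z assume z: "0 \<le> z" "z \<le> \<delta>"
    show "has_density (Z z) z"
      unfolding has_density_def
    proof (intro conjI ballI)
      show "Z z \<in> sets lebesgue"
        unfolding Z_def using finite_T Bmeas by (intro sets.finite_UN) auto
      show "Z z \<subseteq> palette T" unfolding Z_def palette_def using Bsub by blast
      fix t assume t: "t \<in> T"
      have "A t \<inter> Z z = B t (z * measure lebesgue (A t))"
      proof (rule set_eqI)
        fix x
        have "u = t" if "u \<in> T" "x \<in> A t" "x \<in> B u s" for u s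
          using Bsub[OF that(1), of s] disjoint_family_onD[OF disj that(1) t] that by blast
        then show "x \<in> A t \<inter> Z z \<longleftrightarrow> x \<in> B t (z * measure lebesgue (A t))"
          using Bsub[OF t] t unfolding Z_def by blast
      qed
      then show "measure lebesgue (A t \<inter> Z z) = z * measure lebesgue (A t)"
        using B[OF t] z by (simp add: mult_right_mono)
    qed
  next
    show "Z z \<subseteq> palette T \<inter> S" for z unfolding Z_def palette_def using Bsub by blast
  next
    fix y z assume yz: "0 \<le> y" "y \<le> z" "z \<le> \<delta>"
    have "B t (y * measure lebesgue (A t)) \<subseteq> B t (z * measure lebesgue (A t))" if "t \<in> T" for t
      using yz that by (intro Bmono) (auto intro: mult_right_mono)
    then show "Z y \<subseteq> Z z" unfolding Z_def by blast
  qed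
qed

text \<open>\<open>F l I\<close> is the new color of a vertex at distance \<open>l\<close> from the
  center whose old color is \<open>palette I\<close>. Nothing else about the vertex enters, so the
  graph does not appear. Only consecutive levels are compared, since no edge will join two vertices
  of the same level. The last clause fits the boundary of the ball to the unchanged coloring
  outside.\<close>

definition level_coloring :: "nat \<Rightarrow> real set \<Rightarrow> (nat \<Rightarrow> 't set \<Rightarrow> real set) \<Rightarrow> bool" where
  "level_coloring D \<Phi> F \<longleftrightarrow>
      (\<forall>l I. l \<le> 2 * D \<longrightarrow> I \<subseteq> T \<longrightarrow> measure lebesgue (palette I) = 1 \<longrightarrow> unit_set K (F l I))
    \<and> (\<forall>I. F 0 I = \<Phi>)
    \<and> (\<forall>l I J. l < 2 * D \<longrightarrow> I \<subseteq> T \<longrightarrow> measure lebesgue (palette I) = 1 \<longrightarrow>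
        J \<subseteq> T \<longrightarrow> measure lebesgue (palette J) = 1 \<longrightarrow> I \<inter> J = {} \<longrightarrow> F l I \<inter> F (Suc l) J = {})
    \<and> (\<forall>I J. I \<subseteq> T \<longrightarrow> measure lebesgue (palette I) = 1 \<longrightarrow> J \<subseteq> T \<longrightarrow>
        I \<inter> J = {} \<longrightarrow> F (2 * D) I \<inter> palette J = {})"

lemma level_coloringD:
  assumes "level_coloring D \<Phi> F"
  shows "l \<le> 2 * D \<Longrightarrow> I \<subseteq> T \<Longrightarrow> measure lebesgue (palette I) = 1 \<Longrightarrow> unit_set K (F l I)"
    and "F 0 I = \<Phi>"
    and "l < 2 * D \<Longrightarrow> I \<subseteq> T \<Longrightarrow> measure lebesgue (palette I) = 1 \<Longrightarrow>
        J \<subseteq> T \<Longrightarrow> measure lebesgue (palette J) = 1 \<Longrightarrow> I \<inter> J = {} \<Longrightarrow> F l I \<inter> F (Suc l) J = {}"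
    and "I \<subseteq> T \<Longrightarrow> measure lebesgue (palette I) = 1 \<Longrightarrow> J \<subseteq> T \<Longrightarrow>
        I \<inter> J = {} \<Longrightarrow> F (2 * D) I \<inter> palette J = {}"
  using assms unfolding level_coloring_def by simp_all

text \<open>Densities are fixed first, then the chains realizing them, then the colors of even
  levels (\<open>H\<close>) and of odd levels (\<open>N\<close>).\<close>

lemma exists_level_colorings:
  assumes k: "measure lebesgue (palette T) = k" "2 \<le> k" "k < K"
    and D: "0 < D" "1 / K \<le> (K - k) * (\<Sum>j<D. (k - 1) ^ (2 * j + 1))"
    and \<Phi>: "unit_set K \<Phi>"
    "\<And>t. t \<in> T \<Longrightarrow> measure lebesgue (A t \<inter> \<Phi>) = measure lebesgue (A t) / K"
  shows "\<exists>F. level_coloring D \<Phi> F"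
proof -
  have \<Phi>_meas: "\<Phi> \<in> sets lebesgue" and \<Phi>_sub: "\<Phi> \<subseteq> {0..<K}"
    using \<Phi> by (auto simp: unit_set_iff_measure)
  \<comment> \<open>\<open>s\<close> solves the recursion for the densities without an upper bound.
    \<open>q\<close> caps it at 1 / K, the density of \<Phi>, and the hypothesis on the sum says
    that the cap is reached at \<open>D\<close>.\<close>
  define s where "s i = (K - k) * (\<Sum>j<i. (k - 1) ^ (2 * j + 1))" for i
  define q where "q i = min (1 / K) (s i)" for i
  define r where "r i = q i / (k - 1)" for i
  have s_Suc: "s (Suc i) / (k - 1) = (K - k) + (k - 1) * s i" for i
  proof -
    define \<sigma> where "\<sigma> = (\<Sum>j<i. (k - 1) ^ (2 * j + 1))"
    \<comment> \<open>Horner form: split off the term for j = 0 and take (k - 1)^2 out of the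
      others.\<close>
    have "(\<Sum>j<Suc i. (k - 1) ^ (2 * j + 1)) = (k - 1) * (1 + (k - 1) * \<sigma>)"
      unfolding sum.lessThan_Suc_shift \<sigma>_def sum_distrib_left distrib_left
      by (simp add: sum_distrib_left mult.assoc)
    then have "s (Suc i) = (K - k) * ((k - 1) * (1 + (k - 1) * \<sigma>))"
      unfolding s_def by (rule arg_cong)
    moreover have "s i = (K - k) * \<sigma>" by (simp add: s_def \<sigma>_def)
    ultimately have "s (Suc i) = (k - 1) * ((K - k) + (k - 1) * s i)"
      by algebra
    then show ?thesis using k by simp
  qed
  have s_mono: "s i \<le> s j" if "i \<le> j" for i j
    unfolding s_def using k that by (intro mult_left_mono sum_mono2) auto
  have s0: "s 0 = 0" by (simp add: s_def)
  have q0: "q 0 = 0" using k by (simp add: q_def s0)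
  have qD: "q D = 1 / K" using D(2) by (simp add: q_def s_def)
  have q_mono: "q i \<le> q j" if "i \<le> j" for i j using s_mono[OF that] by (auto simp: q_def)
  have q_nonneg: "0 \<le> q i" for i using q_mono[of 0 i] q0 by simp
  have q_le: "q i \<le> 1 / K" for i by (simp add: q_def)
  have r_nonneg: "0 \<le> r i" for i using q_nonneg k by (simp add: r_def)
  have r_mono: "r i \<le> r j" if "i \<le> j" for i j
    using q_mono[OF that] k by (simp add: r_def divide_right_mono)
  have r_q: "(k - 1) * r i = q i" for i using k by (simp add: r_def)
  \<comment> \<open>The sets of density \<open>r i\<close> have to fit outside \<Phi>, where each
    cell has only the proportion 1 - 1 / K left.\<close>
  have r_le: "r i \<le> 1 - 1 / K" for i
  proof -
    have "r i * 1 \<le> r i * (k - 1)" using r_nonneg k by (intro mult_left_mono) auto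
    then have "r i \<le> 1 / K" using q_le[of i] r_q[of i] by (simp add: mult.commute)
    also have "\<dots> \<le> 1 - 1 / K" using k by (simp add: field_simps)
    finally show ?thesis .
  qed
  have r_Suc: "r (Suc i) \<le> (k - 1) * q i + (K - k)" for i
  \<comment> \<open>Before the cap the recursion for \<open>s\<close> gives the bound. After it,
    \<open>r (Suc i)\<close> \<le> \<open>q (Suc i)\<close> \<le> 1 / K \<le> (k - 1) / K
    suffices.\<close>
  proof (cases "s i \<le> 1 / K")
    case True
    have "r (Suc i) \<le> s (Suc i) / (k - 1)"
      unfolding r_def q_def using k by (intro divide_right_mono) auto
    then show ?thesis using True by (simp add: s_Suc q_def min_def)
  next
    case False
    then have "q i = 1 / K" by (simp add: q_def)
    moreover have "r (Suc i) * 1 \<le> r (Suc i) * (k - 1)" using r_nonneg k by (intro mult_left_mono) auto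
    moreover have "1 * (1 / K) \<le> (k - 1) * (1 / K)" using k by (intro mult_right_mono) auto
    ultimately show ?thesis using q_le[of "Suc i"] r_q[of "Suc i"] k by (simp add: mult.commute)
  qed

  obtain Q' where Q': "\<And>z. 0 \<le> z \<Longrightarrow> z \<le> 1 / K \<Longrightarrow> has_density (Q' z) z"
    "\<And>z. Q' z \<subseteq> palette T \<inter> \<Phi>" "\<And>y z. 0 \<le> y \<Longrightarrow> y \<le> z \<Longrightarrow> z \<le> 1 / K \<Longrightarrow> Q' y \<subseteq> Q' z"
    using exists_density_chain[OF \<Phi>_meas, of "1 / K"] \<Phi>(2) by auto
  have \<Phi>_dens: "has_density (palette T \<inter> \<Phi>) (1 / K)"
    unfolding has_density_def
  proof (intro conjI ballI)
    fix t assume t: "t \<in> T"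
    then have "A t \<inter> (palette T \<inter> \<Phi>) = A t \<inter> \<Phi>" by (auto simp: palette_def)
    then show "measure lebesgue (A t \<inter> (palette T \<inter> \<Phi>)) = 1 / K * measure lebesgue (A t)"
      using \<Phi>(2)[OF t] by simp
  qed (use palette_meas[of T] \<Phi>_meas in auto)
  have \<Phi>c_meas: "- \<Phi> \<in> sets lebesgue"
    using sets.compl_sets[OF \<Phi>_meas] by (simp add: Compl_eq_Diff_UNIV)
  have "measure lebesgue (A t \<inter> (- \<Phi>)) = (1 - 1 / K) * measure lebesgue (A t)" if t: "t \<in> T" for t
  proof -
    have "palette {t} = A t" by (simp add: palette_def)
    moreover have "A t - palette T \<inter> \<Phi> = A t \<inter> (- \<Phi>)" using t unfolding palette_def by blast
    ultimately show ?thesis using measure_palette_Diff[OF \<Phi>_dens, of "{t}"] t by simp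
  qed
  then obtain R' where R': "\<And>z. 0 \<le> z \<Longrightarrow> z \<le> 1 - 1 / K \<Longrightarrow> has_density (R' z) z"
    "\<And>z. R' z \<subseteq> palette T \<inter> (- \<Phi>)" "\<And>y z. 0 \<le> y \<Longrightarrow> y \<le> z \<Longrightarrow> z \<le> 1 - 1 / K \<Longrightarrow> R' y \<subseteq> R' z"
    using exists_density_chain[OF \<Phi>c_meas, of "1 - 1 / K"] by auto

  \<comment> \<open>The two ends are set by hand: the chain \<open>Q'\<close> fixes them only up to
    null sets, while disjointness of colors has to hold exactly, at the center and at the boundary
    of the ball.\<close>
  define Q where "Q i = (if i = 0 then {} else if D \<le> i then palette T \<inter> \<Phi> else Q' (q i))" for i
  define R where "R i = R' (r i)" for i
  define X where "X = {0..<K} - palette T"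
  have Q_dens: "has_density (Q i) (q i)" if "i \<le> D" for i
  proof -
    have "has_density {} 0" by (simp add: has_density_def)
    then show ?thesis
      using that \<Phi>_dens Q'(1)[OF q_nonneg q_le, of i] qD by (cases "i = D") (auto simp: Q_def q0)
  qed
  have Q_sub: "Q i \<subseteq> palette T \<inter> \<Phi>" for i using Q'(2) by (auto simp: Q_def)
  have Q_mono: "Q i \<subseteq> Q j" if "i \<le> j" for i j
    using Q'(3)[OF q_nonneg q_mono[OF that] q_le] Q'(2) that by (auto simp: Q_def)
  have R_dens: "has_density (R i) (r i)" for i unfolding R_def by (rule R'(1)[OF r_nonneg r_le])
  have R_sub: "R i \<subseteq> palette T" "R i \<inter> \<Phi> = {}" for i using R'(2) by (auto simp: R_def)
  have R_mono: "R i \<subseteq> R j" if "i \<le> j" for i j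
    unfolding R_def by (rule R'(3)[OF r_nonneg r_mono[OF that] r_le])
  have QR: "Q i \<inter> R j = {}" for i j using Q_sub R_sub by blast
  have X_meas: "X \<in> sets lebesgue" unfolding X_def using palette_meas[of T] by auto
  have X: "measure lebesgue X = K - k"
  proof -
    have "measure lebesgue (X \<union> palette T) = measure lebesgue X + measure lebesgue (palette T)"
      using X_meas palette_meas[of T] palette_sub[of T]
      by (intro measure_Un_disjoint_interval[of _ K]) (auto simp: X_def)
    moreover have "X \<union> palette T = {0..<K}" using palette_sub[of T] by (auto simp: X_def)
    ultimately show ?thesis using k by simp
  qed

  define avail where "avail i I = (palette I \<union> Q i \<union> X) - R (Suc i)" for i I
  have "\<exists>H. unit_set K H \<and> H \<subseteq> avail i I"
    if "i < D" and I: "I \<subseteq> T" "measure lebesgue (palette I) = 1" for i I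
  proof (rule unit_subset_exists)
    have Qd: "has_density (Q i) (q i)" using Q_dens that by simp
    have Qm: "Q i \<in> sets lebesgue" "R (Suc i) \<in> sets lebesgue"
      using Qd R_dens by (auto simp: has_density_def)
    \<comment> \<open>Splitting off \<open>Q i\<close> makes the pieces disjoint. Their total is 1 -
      (q i + r (Suc i)) + k * q i + (K - k), which is at least 1 by \<open>r_Suc\<close>.\<close>
    let ?P = "palette I - (Q i \<union> R (Suc i))"
    have P: "?P \<in> sets lebesgue" "?P \<subseteq> {0..<K}"
      using Qm palette_meas[OF I(1)] palette_sub[OF I(1)] by auto
    have eq: "avail i I = (?P \<union> Q i) \<union> X"
      using R_sub[of "Suc i"] QR[of i "Suc i"] by (auto simp: avail_def X_def)
    have "measure lebesgue (avail i I) = measure lebesgue (?P \<union> Q i) + measure lebesgue X"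
      unfolding eq using P X_meas Qm has_density_sub[OF Qd] palette_mono[OF I(1)] Q_sub[of i]
      by (intro measure_Un_disjoint_interval[of _ K]) (auto simp: X_def)
    also have "measure lebesgue (?P \<union> Q i) = measure lebesgue ?P + measure lebesgue (Q i)"
      using P Qm has_density_sub[OF Qd] by (intro measure_Un_disjoint_interval[of _ K]) auto
    also have "measure lebesgue ?P = 1 - (q i + r (Suc i))"
      using measure_palette_Diff[OF has_density_Un[OF Qd R_dens QR] I(1)] I(2) by simp
    also have "measure lebesgue (Q i) = q i * k"
      using measure_has_density[OF Qd] k by simp
    finally show "1 \<le> measure lebesgue (avail i I)"
      using r_Suc[of i] X by (simp add: algebra_simps)
    show "avail i I \<in> sets lebesgue" unfolding eq using P Qm X_meas by auto
    show "avail i I \<subseteq> {0..<K}"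
      unfolding eq using P has_density_sub[OF Qd] by (auto simp: X_def)
  qed
  then obtain H where H: "\<And>i I. i < D \<Longrightarrow> I \<subseteq> T \<Longrightarrow> measure lebesgue (palette I) = 1 \<Longrightarrow>
      unit_set K (H i I) \<and> H i I \<subseteq> avail i I"
    by metis
  \<comment> \<open>Removing \<open>Q i\<close> loses \<open>q i\<close>, and adding
    \<open>R i\<close> gains (k - 1) * r i because a part \<open>r i\<close> of the palette was
    already inside \<open>R i\<close>. The two balance exactly.\<close>
  define N where "N i I = (palette I - Q i) \<union> R i" for i I
  have N_unit: "unit_set K (N i I)"
    if "i \<le> D" and I: "I \<subseteq> T" "measure lebesgue (palette I) = 1" for i I
  proof -
    have Qd: "has_density (Q i) (q i)" using Q_dens that by simp
    have Qm: "Q i \<in> sets lebesgue" "R i \<in> sets lebesgue"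
      using Qd R_dens by (auto simp: has_density_def)
    let ?P = "palette I - (Q i \<union> R i)"
    have P: "?P \<in> sets lebesgue" "?P \<subseteq> {0..<K}"
      using Qm palette_meas[OF I(1)] palette_sub[OF I(1)] by auto
    have eq: "N i I = ?P \<union> R i" by (auto simp: N_def)
    have "measure lebesgue (N i I) = measure lebesgue ?P + measure lebesgue (R i)"
      unfolding eq using P Qm has_density_sub[OF R_dens]
      by (intro measure_Un_disjoint_interval[of _ K]) auto
    also have "measure lebesgue ?P = 1 - (q i + r i)"
      using measure_palette_Diff[OF has_density_Un[OF Qd R_dens QR] I(1)] I(2) by simp
    also have "measure lebesgue (R i) = r i * k"
      using measure_has_density[OF R_dens] k by simp
    finally have "measure lebesgue (N i I) = 1"
      using r_q[of i] by (simp add: algebra_simps)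
    then show ?thesis
      unfolding unit_set_iff_measure eq using P Qm has_density_sub[OF R_dens] by auto
  qed
  \<comment> \<open>An even level with index \<open>i\<close> borders the odd level with index
    \<open>i\<close> on its outer side and \<open>Suc i\<close> on its inner side. Monotonicity of
    both chains covers both: \<open>Q i\<close> lies in \<open>Q j\<close>, and \<open>R j\<close>
    lies in \<open>R (Suc i)\<close>.\<close>
  have avail_N: "avail i I \<inter> N j J = {}"
    if "j = i \<or> j = Suc i" "I \<subseteq> T" "J \<subseteq> T" "I \<inter> J = {}" for i j I J
    using that palette_disjoint[of I J] palette_mono[of J T] R_mono[of j "Suc i"] R_sub(1)[of j]
      Q_mono[of i j] unfolding avail_def N_def X_def by auto
  have \<Phi>_N: "\<Phi> \<inter> N D J = {}" if "J \<subseteq> T" for J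
    using palette_mono[OF that] R_sub(2)[of D] D(1) by (auto simp: N_def Q_def)

  \<comment> \<open>The index \<open>D - l div 2\<close> falls with the distance: levels 2m and 2m +
    1 share the index D - m, so level 1 has index \<open>D\<close> and level 2D has index 0.\<close>
  define F where "F l I = (if l = 0 then \<Phi> else
      if even l then H (D - l div 2) I else N (D - l div 2) I)" for l I
  have "level_coloring D \<Phi> F"
    unfolding level_coloring_def
  proof (intro conjI allI impI)
    show "unit_set K (F l I)"
      if "l \<le> 2 * D" "I \<subseteq> T" "measure lebesgue (palette I) = 1" for l I
      using that \<Phi>(1) N_unit H[of "D - l div 2" I] by (auto simp: F_def elim!: evenE)
    show "F 0 I = \<Phi>" for I by (simp add: F_def)
    show "F (2 * D) I \<inter> palette J = {}"
      if IJ: "I \<subseteq> T" "measure lebesgue (palette I) = 1" "J \<subseteq> T" "I \<inter> J = {}" for I J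
    proof -
      have "F (2 * D) I = H 0 I" using D(1) by (simp add: F_def)
      then have "F (2 * D) I \<subseteq> palette I \<union> X"
        using H[OF D(1) IJ(1,2)] by (auto simp: avail_def Q_def)
      then show ?thesis
        using palette_disjoint[OF IJ(1,3,4)] palette_mono[OF IJ(3)] by (auto simp: X_def)
    qed
    fix l I J
    assume l: "l < 2 * D" and IJ: "I \<subseteq> T" "measure lebesgue (palette I) = 1"
      "J \<subseteq> T" "measure lebesgue (palette J) = 1" "I \<inter> J = {}"
    show "F l I \<inter> F (Suc l) J = {}"
    proof (cases "even l")
      case True
      then obtain m where m: "l = 2 * m" by (elim evenE)
      have "F (Suc l) J = N (D - m) J" by (simp add: F_def m)
      moreover have "F l I = H (D - m) I \<and> D - m < D" if "m > 0"
        using that l m by (auto simp: F_def)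
      ultimately show ?thesis
        using \<Phi>_N[OF IJ(3)] avail_N[of "D - m" "D - m" I J] H[of "D - m" I] IJ
        by (cases "m = 0") (auto simp: F_def m)
    next
      case False
      then obtain m where m: "l = 2 * m + 1" by (elim oddE)
      have "F l I = N (D - m) I" by (simp add: F_def m)
      moreover have "F (Suc l) J = H (D - Suc m) J" by (simp add: F_def m)
      moreover have "D - Suc m < D" "D - m = Suc (D - Suc m)" using l m by auto
      ultimately show ?thesis
        using avail_N[of "D - m" "D - Suc m" J I] H[of "D - Suc m" J] IJ
        by (auto simp: Int_commute[of J I])
    qed
  qed
  then show ?thesis by blast
qed

end

section \<open>Walks in the graph and the atoms of its coloring\<close>

lemma exists_walk_if_relpowp:
  assumes "(E ^^ n) u v"
  shows "\<exists>p. walk_from_to E u v p \<and> length p = Suc n"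
  using assms
proof (induction n arbitrary: v)
  case 0
  then show ?case by (intro exI[of _ "[u]"]) (simp add: walk_from_to_def)
next
  case (Suc n)
  then obtain y where y: "(E ^^ n) u y" "E y v" by auto
  then obtain p where p: "walk_from_to E u y p" "length p = Suc n" using Suc.IH by blast
  have "E ((p @ [v]) ! i) ((p @ [v]) ! Suc i)" if "Suc i < length (p @ [v])" for i
  proof (cases "Suc i < length p")
    case True
    then show ?thesis using p by (simp add: walk_from_to_def nth_append)
  next
    case False
    then have i: "i = length p - 1" "Suc i = length p" using that p by auto
    have "p \<noteq> []" "last p = y" using p by (simp_all add: walk_from_to_def)
    then have "p ! i = y" using last_conv_nth[of p] i(1) by simp
    then show ?thesis using i y p by (simp add: nth_append)
  qed
  then have "walk_from_to E u v (p @ [v])" using p by (simp add: walk_from_to_def)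
  then show ?case using p by (intro exI[of _ "p @ [v]"]) simp
qed

lemma relpowp_sym:
  assumes "\<And>u v. E u v \<Longrightarrow> E v u"
  shows "(E ^^ n) u v \<Longrightarrow> (E ^^ n) v u"
proof (induction n arbitrary: v)
  case (Suc n)
  then obtain y where "(E ^^ n) u y" "E y v" by auto
  then have "E v y" "(E ^^ n) y u" using Suc.IH assms by blast+
  then show ?case by (rule relpowp_Suc_I2)
qed simp

text \<open>For consecutive vertices x, y, v of a walk, the sets c v - c x, c x and c y are disjoint
  in [0, k), so the first has measure at most k - 2. These differences add up along the walk, since
  c v - c u is covered by c v - c x and c x - c u.\<close>

lemma even_walk_color_drift:
  assumes E: "\<And>u v. E u v \<Longrightarrow> u \<in> V \<and> v \<in> V"
    and c: "fractional_coloring V E k c"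
  shows "(E ^^ (2 * n)) u v \<Longrightarrow> u \<in> V \<Longrightarrow> measure lebesgue (c v - c u) \<le> real n * (k - 2)"
proof (induction n arbitrary: v)
  case (Suc n)
  then obtain x y where xy: "(E ^^ (2 * n)) u x" "E x y" "E y v" by auto
  have col: "c z \<subseteq> {0..<k}" "c z \<in> sets lebesgue" "measure lebesgue (c z) = 1" if "z \<in> V" for z
    using c that by (auto simp: fractional_coloring_def unit_set_iff_measure)
  have V: "x \<in> V" "y \<in> V" "v \<in> V" using E xy by blast+
  have Lk: "{0..<k} \<in> lmeasurable" by (rule lmeasurable_of_subset_interval[of _ k]) auto
  have dis: "c x \<inter> c y = {}" "c y \<inter> c v = {}"
    using c V xy by (auto simp: fractional_coloring_def)
  have step: "measure lebesgue (c v - c x) \<le> k - 2"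
  proof -
    have "measure lebesgue ((c v - c x) \<union> (c x \<union> c y)) \<le> measure lebesgue {0..<k}"
      using col(1,2)[OF V(1)] col(1,2)[OF V(2)] col(1,2)[OF V(3)] Lk
      by (intro measure_mono_fmeasurable) auto
    moreover have "measure lebesgue ((c v - c x) \<union> (c x \<union> c y))
        = measure lebesgue (c v - c x) + measure lebesgue (c x \<union> c y)"
      using col(1,2)[OF V(1)] col(1,2)[OF V(2)] col(1,2)[OF V(3)] dis
      by (intro measure_Un_disjoint_interval[of _ k]) auto
    moreover have "measure lebesgue (c x \<union> c y) = 1 + 1"
      using measure_Un_disjoint_interval[OF col(2,1)[OF V(1)] col(2,1)[OF V(2)] dis(1)]
        col(3) V by simp
    moreover have "measure lebesgue (c x) \<le> measure lebesgue {0..<k}"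
      using col(1,2)[OF V(1)] Lk by (intro measure_mono_fmeasurable) auto
    then have "0 \<le> k" using col(3)[OF V(1)] by (cases "0 \<le> k") auto
    ultimately show ?thesis by simp
  qed
  have m: "c v - c x \<in> sets lebesgue" "c x - c u \<in> sets lebesgue" "c v - c u \<in> sets lebesgue"
    using col(2) V Suc.prems by blast+
  have lm: "c v - c x \<in> lmeasurable" "c x - c u \<in> lmeasurable"
    by (rule lmeasurable_of_subset_interval[of _ k]; use m col(1) V in blast)+
  have "measure lebesgue (c v - c u) \<le> measure lebesgue ((c v - c x) \<union> (c x - c u))"
    using m lm by (intro measure_mono_fmeasurable fmeasurable.Un) auto
  also have "\<dots> \<le> measure lebesgue (c v - c x) + measure lebesgue (c x - c u)"
    using m by (intro measure_Un_le)
  also have "\<dots> \<le> (k - 2) + real n * (k - 2)"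
    using step Suc.IH[OF xy(1)] Suc.prems by simp
  finally show ?case by (simp add: algebra_simps)
qed simp

text \<open>Reversing one walk and appending the other gives a walk of length 2n from
  \<open>u\<close> to \<open>v\<close>, along which the color moves by less than 1. Adjacency would
  make the two colors disjoint, a move of exactly 1.\<close>

lemma no_short_odd_closed_walk:
  assumes G: "simple_graph V E" and c: "fractional_coloring V E k c" and n: "real n * (k - 2) < 1"
    and walks: "(E ^^ n) w u" "(E ^^ n) w v"
  shows "\<not> E u v"
proof
  assume uv: "E u v"
  have E: "\<And>u v. E u v \<Longrightarrow> u \<in> V \<and> v \<in> V" and sym: "\<And>u v. E u v \<Longrightarrow> E v u"
    using G by (auto simp: simple_graph_def)
  have "(E ^^ (n + n)) u v"
    unfolding relpowp_add using relpowp_sym[OF sym walks(1)] walks(2) by blast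
  then have "measure lebesgue (c v - c u) \<le> real n * (k - 2)"
    using even_walk_color_drift[OF E c, of n u v] E[OF uv] by (simp add: mult_2)
  moreover have "c u \<inter> c v = {}" "measure lebesgue (c v) = 1"
    using c E[OF uv] uv by (auto simp: fractional_coloring_def unit_set_iff_measure)
  then have "measure lebesgue (c v - c u) = 1" by (metis Diff_triv Int_commute)
  ultimately show False using n by simp
qed

text \<open>A point of [0, k) is classified by the set of vertices that use it. \<open>T\<close>
  holds only the sets that occur, rather than all subsets of \<open>V\<close>; hence no member of
  \<open>T\<close> contains both ends of an edge, even when its weight is 0.\<close>

lemma exists_color_atoms:
  assumes "finite V" "fractional_coloring V E k c" "0 \<le> k"
  obtains T :: "'a set set" and a :: "'a set \<Rightarrow> real"
  where "finite T" "\<And>t. 0 \<le> a t" "sum a T = k"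
    "\<And>v. v \<in> V \<Longrightarrow> sum a {t\<in>T. v \<in> t} = 1"
    "\<And>u v. u \<in> V \<Longrightarrow> v \<in> V \<Longrightarrow> E u v \<Longrightarrow> {t\<in>T. u \<in> t} \<inter> {t\<in>T. v \<in> t} = {}"
proof -
  define g where "g x = {v\<in>V. x \<in> c v}" for x
  define T where "T = g ` {0..<k}"
  define P where "P t = {x\<in>{0..<k}. g x = t}" for t
  define a where "a t = measure lebesgue (P t)" for t
  have col: "c v \<subseteq> {0..<k}" "c v \<in> sets lebesgue" "measure lebesgue (c v) = 1" if "v \<in> V" for v
    using assms that by (auto simp: fractional_coloring_def unit_set_iff_measure)
  have fin: "finite T"
  proof (rule finite_subset)
    show "T \<subseteq> Pow V" by (auto simp: T_def g_def)
  qed (use assms in simp)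
  have Pm: "P t \<in> sets lebesgue" for t
    unfolding P_def g_def using assms(1) col by (intro atom_measurable) auto
  have sum_eq: "sum a S = measure lebesgue (\<Union>t\<in>S. P t)" if "S \<subseteq> T" for S
    unfolding a_def
  proof (rule measure_UNION_disjoint[of _ _ k, symmetric])
    show "finite S" using that fin by (rule finite_subset)
    show "disjoint_family_on P S" by (auto simp: disjoint_family_on_def P_def)
    show "P t \<in> sets lebesgue" "P t \<subseteq> {0..<k}" for t using Pm by (auto simp: P_def)
  qed
  show thesis
  proof (rule that[of T a])
    show "finite T" by fact
    show "0 \<le> a t" for t by (simp add: a_def)
    have "(\<Union>t\<in>T. P t) = {0..<k}" by (auto simp: P_def T_def)
    then show "sum a T = k" using sum_eq[OF order_refl] assms(3) by simp
    show "sum a {t\<in>T. v \<in> t} = 1" if v: "v \<in> V" for v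
    proof -
      have "x \<in> (\<Union>t\<in>{t\<in>T. v \<in> t}. P t) \<longleftrightarrow> x \<in> {0..<k} \<and> v \<in> g x" for x
        by (auto simp: P_def T_def)
      then have "(\<Union>t\<in>{t\<in>T. v \<in> t}. P t) = c v"
        using col(1)[OF v] v by (auto simp: g_def simp del: UN_iff)
      then show ?thesis using sum_eq[of "{t\<in>T. v \<in> t}"] col(3)[OF v] by simp
    qed
    show "{t\<in>T. u \<in> t} \<inter> {t\<in>T. v \<in> t} = {}" if "u \<in> V" "v \<in> V" "E u v" for u v
    proof (rule equals0I)
      fix t assume "t \<in> {t\<in>T. u \<in> t} \<inter> {t\<in>T. v \<in> t}"
      then obtain x where "x \<in> c u" "x \<in> c v" by (auto simp: T_def g_def)
      then show False using assms(2) that unfolding fractional_coloring_def by blast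
    qed
  qed
qed

section \<open>Gluing the colorings of the balls to the coloring outside\<close>

theorem mainTheorem11:
  fixes d :: int and k \<epsilon> :: real and V :: "'a set" and E :: "'a \<Rightarrow> 'a \<Rightarrow> bool"
    and W :: "'a set" and \<phi> :: "'a \<Rightarrow> real set"
  assumes "d \<ge> 6" and "d mod 4 = 2"
    and "k \<in> \<rat>" and "\<epsilon> > 0"
    and "2 \<le> k" and "k < 2 + 1 / (2 * real_of_int (d div 4))"
    and "\<epsilon> * (\<Sum>j<nat (d div 4). (k - 1) ^ (2 * j + 1)) \<ge> 1 / (k + \<epsilon>)"
    and "simple_graph V E"
    and "fractionally_colorable V E k"
    and "W \<subseteq> V"
    and "\<forall>u\<in>W. \<forall>v\<in>W. u \<noteq> v \<longrightarrow> dist_ge E u v (nat d)"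
    and "fractional_precoloring W (k + \<epsilon>) \<phi>"
  shows "precoloring_extends V E W (k + \<epsilon>) \<phi>"
proof -
  define D where "D = nat (d div 4)"
  define K where "K = k + \<epsilon>"
  have D: "0 < D" "real_of_int (d div 4) = real D"
    using assms(1) by (auto simp: D_def)
  have d: "nat d = 4 * D + 2"
  proof -
    have "d = 4 * (d div 4) + 2" using assms(2) mult_div_mod_eq[of 4 d] by simp
    moreover have "0 \<le> d div 4" using assms(1) by simp
    ultimately show ?thesis unfolding D_def by linarith
  qed
  have K: "0 < K" "0 \<le> k" "k < K" using assms by (auto simp: K_def)
  \<comment> \<open>The upper bound on \<open>k\<close> is the case n = 2 * D.\<close>
  have short: "real n * (k - 2) < 1" if "n \<le> 2 * D" for n
  proof -
    have "real n * (k - 2) \<le> real (2 * D) * (k - 2)"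
      using that assms by (intro mult_right_mono) (simp_all only: of_nat_le_iff)
    also have "\<dots> < real (2 * D) * (1 / (2 * real D))"
      using assms(6) D by (intro mult_strict_left_mono) auto
    finally show ?thesis using D by simp
  qed
  have E: "\<And>u v. E u v \<Longrightarrow> u \<in> V \<and> v \<in> V" and sym: "\<And>u v. E u v \<Longrightarrow> E v u" and "finite V"
    using assms(8) by (auto simp: simple_graph_def)
  obtain c where c: "fractional_coloring V E k c"
    using assms(9) by (auto simp: fractionally_colorable_def)
  obtain T :: "'a set set" and a where T: "finite T" "\<And>t. 0 \<le> a t" "sum a T = k"
    "\<And>v. v \<in> V \<Longrightarrow> sum a {t\<in>T. v \<in> t} = 1"
    "\<And>u v. u \<in> V \<Longrightarrow> v \<in> V \<Longrightarrow> E u v \<Longrightarrow> {t\<in>T. u \<in> t} \<inter> {t\<in>T. v \<in> t} = {}"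
    using exists_color_atoms[OF \<open>finite V\<close> c K(2)] by blast
  have \<phi>: "unit_set K (\<phi> w)" "\<phi> w \<subseteq> {0..<K}" "\<phi> w \<in> sets lebesgue" "measure lebesgue (\<phi> w) = 1"
    if "w \<in> W" for w
    using assms(12) that by (auto simp: fractional_precoloring_def K_def unit_set_iff_measure)
  have sum_le: "sum a T \<le> K" using T(3) K(3) by simp
  obtain A where A: "disjoint_family_on A T" "\<And>t. t \<in> T \<Longrightarrow> A t \<subseteq> {0..<K}"
    "\<And>t. t \<in> T \<Longrightarrow> A t \<in> sets lebesgue" "\<And>t. t \<in> T \<Longrightarrow> measure lebesgue (A t) = a t"
    "\<And>t w. t \<in> T \<Longrightarrow> w \<in> W \<Longrightarrow> measure lebesgue (A t \<inter> \<phi> w) = a t * measure lebesgue (\<phi> w) / K"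
    using exists_equidistributed_family[where a = a and \<phi> = \<phi>, OF
        finite_subset[OF assms(10) \<open>finite V\<close>] K(1) \<phi>(3) \<phi>(2) T(1) T(2) sum_le] by blast
  interpret color_cells T A K by unfold_locales (use T A in auto)
  \<comment> \<open>\<open>palette (I v)\<close> is the old color of \<open>v\<close> moved into [0,
    K).\<close>
  define I where "I v = {t\<in>T. v \<in> t}" for v
  have I_sub: "I v \<subseteq> T" for v by (auto simp: I_def)
  have measure_sum: "measure lebesgue (palette J) = sum a J" if "J \<subseteq> T" for J
    unfolding measure_palette[OF that] using that A(4) by (intro sum.cong) auto
  have I_unit: "measure lebesgue (palette (I v)) = 1" if "v \<in> V" for v
    using measure_sum[OF I_sub] T(4)[OF that] by (simp add: I_def)
  have I_disj: "I u \<inter> I v = {}" if "E u v" for u v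
    using T(5) that E unfolding I_def by blast

  have "\<forall>w\<in>W. \<exists>F. level_coloring D (\<phi> w) F"
  proof
    fix w assume w: "w \<in> W"
    show "\<exists>F. level_coloring D (\<phi> w) F"
    proof (rule exists_level_colorings)
      show "measure lebesgue (palette T) = k" using measure_sum[OF order_refl] T(3) by simp
      show "1 / K \<le> (K - k) * (\<Sum>j<D. (k - 1) ^ (2 * j + 1))"
        using assms(7) by (simp add: K_def D_def)
      show "measure lebesgue (A t \<inter> \<phi> w) = measure lebesgue (A t) / K" if "t \<in> T" for t
        using A(4,5) \<phi>(4) that w by simp
    qed (use assms(5) K(3) D(1) \<phi>(1)[OF w] in auto)
  qed
  from bchoice[OF this] obtain F where F: "\<And>w. w \<in> W \<Longrightarrow> level_coloring D (\<phi> w) (F w)" by blast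
  have F_unit: "unit_set K (F w l (I v))" if "w \<in> W" "l \<le> 2 * D" "v \<in> V" for w l v
    by (rule level_coloringD(1)[OF F[OF that(1)] that(2) I_sub I_unit[OF that(3)]])
  have F_0: "F w 0 J = \<phi> w" if "w \<in> W" for w J
    by (rule level_coloringD(2)[OF F[OF that]])
  have F_step: "F w l (I u) \<inter> F w (Suc l) (I v) = {}" if "w \<in> W" "l < 2 * D" "E u v" for w l u v
    using E[OF that(3)]
    by (intro level_coloringD(3)[OF F[OF that(1)] that(2)] I_sub I_unit I_disj[OF that(3)]) auto
  have F_last: "F w (2 * D) (I u) \<inter> palette (I v) = {}" if "w \<in> W" "E u v" for w u v
    using E[OF that(2)]
    by (intro level_coloringD(4)[OF F[OF that(1)]] I_sub I_unit I_disj[OF that(2)]) auto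

  \<comment> \<open>Balls of radius 2 * D around the precolored vertices; \<open>lev\<close> is the
    distance to the center and is meaningful only when \<open>w\<close> reaches
    \<open>v\<close>.\<close>
  define near where "near w v \<longleftrightarrow> w \<in> W \<and> (\<exists>n\<le>2 * D. (E ^^ n) w v)" for w v
  define lev where "lev w v = (LEAST n. (E ^^ n) w v)" for w v
  have lev_le: "lev w v \<le> n" if "(E ^^ n) w v" for n w v
    unfolding lev_def using that by (rule Least_le)
  have lev: "w \<in> W" "(E ^^ lev w v) w v" "lev w v \<le> 2 * D" if "near w v" for w v
    using that unfolding near_def lev_def by (auto intro: LeastI Least_le order_trans)
  have sep: "w = w'" if "w \<in> W" "w' \<in> W" "(E ^^ n) w w'" "n < nat d" for w w' n
  proof (rule ccontr)
    assume "w \<noteq> w'"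
    then have "dist_ge E w w' (nat d)" using assms(11) that by blast
    then show False using exists_walk_if_relpowp[OF that(3)] that(4) by (fastforce simp: dist_ge_def)
  qed
  have near_unique: "w = w'" if "near w u" "near w' u" for w w' u
  proof -
    have "(E ^^ (lev w u + lev w' u)) w w'"
      unfolding relpowp_add using lev(2)[OF that(1)] relpowp_sym[OF sym lev(2)[OF that(2)]] by blast
    then show ?thesis using sep lev[OF that(1)] lev[OF that(2)] d by fastforce
  qed
  \<comment> \<open>Two radii and the edge give a walk of length at most 4 * D + 1, just below the
    distance 4 * D + 2 required between distinct centers.\<close>
  have near_adj: "w = w'" if "near w u" "near w' v" "E u v" for w w' u v
  proof -
    have "(E ^^ (Suc (lev w u) + lev w' v)) w w'"
      unfolding relpowp_add
      using relpowp_Suc_I[OF lev(2)[OF that(1)] that(3)] relpowp_sym[OF sym lev(2)[OF that(2)]] by blast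
    then show ?thesis using sep lev[OF that(1)] lev[OF that(2)] d by fastforce
  qed
  define f where "f v = (if \<exists>w. near w v then let w = THE w. near w v in F w (lev w v) (I v)
      else palette (I v))" for v
  have f_near: "f v = F w (lev w v) (I v)" if "near w v" for w v
  proof -
    have "(THE w. near w v) = w" using that near_unique by (intro the_equality) blast+
    then show ?thesis using that by (auto simp: f_def Let_def)
  qed
  have f_far: "f v = palette (I v)" if "\<nexists>w. near w v" for v using that by (simp add: f_def)
  \<comment> \<open>Here \<open>u\<close> is the end lying in a ball and not farther from its
    center. The comparison of levels is vacuous when \<open>v\<close> lies in no ball.\<close>
  have disj_le: "f u \<inter> f v = {}"
    if uv: "E u v" and w: "near w u" and le: "\<And>w. near w v \<Longrightarrow> lev w u \<le> lev w v" for u v w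
  proof (cases "\<exists>w. near w v")
    case True
    then have v: "near w v" using near_adj[OF w _ uv] by blast
    \<comment> \<open>Equal levels would close an odd walk of length at most 4 * D + 1, so the
      levels are consecutive and \<open>F_step\<close> applies.\<close>
    have "lev w v \<le> Suc (lev w u)" by (rule lev_le[OF relpowp_Suc_I[OF lev(2)[OF w] uv]])
    moreover have "lev w u \<noteq> lev w v"
      using no_short_odd_closed_walk[OF assms(8) c short[OF lev(3)[OF w]] lev(2)[OF w], of v]
        lev(2)[OF v] uv by auto
    ultimately have "lev w v = Suc (lev w u)" using le[OF v] by simp
    then show ?thesis
      using F_step[OF lev(1)[OF w] _ uv, of "lev w u"] lev(3)[OF v] f_near[OF w] f_near[OF v] by simp
  next
    case False
    \<comment> \<open>An edge leaves the ball only from its outermost level, where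
      \<open>F_last\<close> applies.\<close>
    have "lev w u = 2 * D"
    proof (rule ccontr)
      assume "lev w u \<noteq> 2 * D"
      then have "near w v"
        unfolding near_def using lev[OF w] relpowp_Suc_I[OF lev(2)[OF w] uv]
        by (intro conjI exI[of _ "Suc (lev w u)"]) auto
      then show False using False by blast
    qed
    then show ?thesis using F_last[OF lev(1)[OF w] uv] f_near[OF w] f_far[OF False] by simp
  qed
  have disj_f: "f u \<inter> f v = {}" if uv: "E u v" for u v
  proof -
    \<comment> \<open>If both ends lie in balls, \<open>near_adj\<close> gives them the same center,
      so their levels can be compared.\<close>
    consider "\<nexists>w. near w u" "\<nexists>w. near w v" | w where "near w u" "\<And>w. near w v \<Longrightarrow> lev w u \<le> lev w v"
      | w where "near w v" "\<And>w. near w u \<Longrightarrow> lev w v \<le> lev w u"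
      using near_adj[OF _ _ uv] by (metis linear)
    then show ?thesis
    proof cases
      case 1
      then show ?thesis using palette_disjoint[OF I_sub I_sub I_disj[OF uv]] by (simp add: f_far)
    next
      case 2
      then show ?thesis by (rule disj_le[OF uv])
    next
      case 3
      then have "f v \<inter> f u = {}" by (rule disj_le[OF sym[OF uv]])
      then show ?thesis by blast
    qed
  qed
  have f_unit: "unit_set K (f v)" if v: "v \<in> V" for v
  proof (cases "\<exists>w. near w v")
    case True
    then show ?thesis using f_near lev F_unit v by metis
  next
    case False
    then show ?thesis
      using f_far I_unit[OF v] palette_meas[OF I_sub] palette_sub[OF I_sub]
      by (simp add: unit_set_iff_measure)
  qed
  have "f w = \<phi> w" if w: "w \<in> W" for w
  proof -
    have "near w w" unfolding near_def using w by (intro conjI exI[of _ 0]) auto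
    moreover have "lev w w = 0" using lev_le[of 0 w w] by simp
    ultimately show ?thesis using f_near F_0[OF w] by simp
  qed
  moreover have "fractional_coloring V E K f"
    unfolding fractional_coloring_def using f_unit disj_f by blast
  ultimately show ?thesis unfolding precoloring_extends_def K_def by blast
qed

end
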